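(* Let $n\ge 1$, let $B\in\mathcal{M}_{n\times n}(\mathbb{R})$ be either a positive or an inverse-positive matrix, let $(X,d)$ be a complete vector $B$-metric space with $X$ nonempty, and let $N\colon X\to X$ be an operator. Assume that there exists a matrix $A\in\mathcal{M}_{n\times n}(\mathbb{R}_+)$ convergent to zero such that $$d(N(x),N(y))\le A\,d(x,y)\quad\text{for all }x,y\in X.$$ Then $N$ has a unique fixed point.
   Context: Vectors in $\mathbb{R}^n$ are columns; inequalities between vectors (and between matrices of the same size) and convergence of sequences of vectors or matrices are understood componentwise; $\mathbb{R}_+=[0,\infty)$. For a set $X$ and an arbitrary matrix $B\in\mathcal{M}_{n\times n}(\mathbb{R})$, a vector $B$-metric on $X$ is a mapping $d\colon X\times X\to\mathbb{R}^n_+$ such that for all $u,v,w\in X$: $d(u,v)=0$ if and only if $u=v$; $d(u,v)=d(v,u)$; and $d(u,w)\le B\,(d(u,v)+d(v,w))$. Then $(X,d)$ is called a vector $B$-metric space. A sequence $(x_k)$ converges to $x$ if $d(x_k,x)\to 0$; it is Cauchy if $d(x_k,x_p)\to0$ as $k,p\to\infty$; $(X,d)$ is complete if every Cauchy sequence converges to a point of $X$. A matrix is positive if all its entries are nonnegative; a square real matrix is inverse-positive if it is invertible and its inverse is positive; a positive matrix $M$ is convergent to zero if $M^k\to 0$ as $k\to\infty$. *)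

theory Defs
  imports "HOL-Analysis.Analysis"
begin

text \<open>
  On \<open>real ^ 'n\<close> and \<open>real ^ 'n ^ 'n\<close> the order \<open>\<le>\<close> and the topology of the library
  are componentwise.
\<close>

definition positive_mat :: "real ^ 'n ^ 'n \<Rightarrow> bool" where
  "positive_mat M \<longleftrightarrow> 0 \<le> M"

definition inverse_positive_mat :: "real ^ 'n ^ 'n \<Rightarrow> bool" where
  "inverse_positive_mat M \<longleftrightarrow> invertible M \<and> positive_mat (matrix_inv M)"

text \<open>The library's \<open>^\<close> on \<open>real ^ 'n ^ 'n\<close> is the entrywise power, hence a separate
  power with respect to the matrix product.\<close>

primrec matpow :: "real ^ 'n ^ 'n \<Rightarrow> nat \<Rightarrow> real ^ 'n ^ 'n" where
  "matpow M 0 = mat 1"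
| "matpow M (Suc k) = M ** matpow M k"

definition convergent_to_zero :: "real ^ 'n ^ 'n \<Rightarrow> bool" where
  "convergent_to_zero M \<longleftrightarrow> matpow M \<longlonglongrightarrow> 0"

definition vector_B_metric :: "real ^ 'n ^ 'n \<Rightarrow> 'a set \<Rightarrow> ('a \<Rightarrow> 'a \<Rightarrow> real ^ 'n) \<Rightarrow> bool" where
  "vector_B_metric B X d \<longleftrightarrow>
     (\<forall>u\<in>X. \<forall>v\<in>X. 0 \<le> d u v) \<and>
     (\<forall>u\<in>X. \<forall>v\<in>X. d u v = 0 \<longleftrightarrow> u = v) \<and>
     (\<forall>u\<in>X. \<forall>v\<in>X. d u v = d v u) \<and>
     (\<forall>u\<in>X. \<forall>v\<in>X. \<forall>w\<in>X. d u w \<le> B *v (d u v + d v w))"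

definition vconverges :: "('a \<Rightarrow> 'a \<Rightarrow> real ^ 'n) \<Rightarrow> (nat \<Rightarrow> 'a) \<Rightarrow> 'a \<Rightarrow> bool" where
  "vconverges d x l \<longleftrightarrow> (\<lambda>k. d (x k) l) \<longlonglongrightarrow> 0"

definition vCauchy :: "('a \<Rightarrow> 'a \<Rightarrow> real ^ 'n) \<Rightarrow> (nat \<Rightarrow> 'a) \<Rightarrow> bool" where
  "vCauchy d x \<longleftrightarrow> ((\<lambda>(k, p). d (x k) (x p)) \<longlongrightarrow> 0) (sequentially \<times>\<^sub>F sequentially)"

definition vcomplete :: "'a set \<Rightarrow> ('a \<Rightarrow> 'a \<Rightarrow> real ^ 'n) \<Rightarrow> bool" where
  "vcomplete X d \<longleftrightarrow>
     (\<forall>x. (\<forall>k. x k \<in> X) \<and> vCauchy d x \<longrightarrow> (\<exists>l\<in>X. vconverges d x l))"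

end

theory Submission
  imports Defs
begin

text \<open>
  On nonnegative vectors the Euclidean norm is monotone. The vector \<open>B *v (d u v + d v w)\<close> dominates
  \<open>d u w \<ge> 0\<close>, so passing to norms shows that \<open>\<rho> u v = norm (d u v)\<close> satisfies the scalar relaxed
  triangle inequality \<open>\<rho> u w \<le> s * (\<rho> u v + \<rho> v w)\<close> with \<open>s = norm B\<close>. Thus \<open>(X, \<rho>)\<close> is a b-metric
  space, and it is complete because convergence of vectors to 0 is convergence of their norms.

  Iterating the contraction condition, which uses \<open>A \<ge> 0\<close>, shows that \<open>N ^^ m\<close> has the Lipschitz
  constant \<open>norm (matpow A m)\<close> with respect to \<open>\<rho>\<close>. As \<open>A\<close> is convergent to zero, some power \<open>m\<close>
  makes this constant \<open>c\<close> so small that \<open>c < 1\<close> and \<open>s * c < 1\<close>. Under these conditions the Picard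
  iterates of a self-map of a b-metric space form a Cauchy sequence, and their limit is the
  unique fixed point (\<open>b_metric_contraction_fixed_point\<close>). Finally, \<open>N\<close> maps fixed
  points of \<open>N ^^ m\<close> to fixed points of \<open>N ^^ m\<close>; there is just one, so \<open>N\<close> itself fixes it.
\<close>

section \<open>Contractions of b-metric spaces\<close>

text \<open>
  The first step \<open>T x\<close> serves as the intermediate point: the distance from \<open>x\<close> to the \<open>p\<close>-th
  iterate is then at most \<open>s * \<rho> x (T x)\<close> plus \<open>s * c\<close> times the same quantity for \<open>p - 1\<close>. Since
  \<open>s * c < 1\<close>, the fixed point of this affine recursion bounds the whole orbit.
\<close>

lemma b_metric_orbit_bounded:
  fixes \<rho> :: "'a \<Rightarrow> 'a \<Rightarrow> real"
  assumes refl: "\<And>u. u \<in> X \<Longrightarrow> \<rho> u u = 0"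
    and nonneg: "\<And>u v. u \<in> X \<Longrightarrow> v \<in> X \<Longrightarrow> 0 \<le> \<rho> u v"
    and tri: "\<And>u v w. u \<in> X \<Longrightarrow> v \<in> X \<Longrightarrow> w \<in> X \<Longrightarrow> \<rho> u w \<le> s * (\<rho> u v + \<rho> v w)"
    and T: "\<And>u. u \<in> X \<Longrightarrow> T u \<in> X"
    and contr: "\<And>u v. u \<in> X \<Longrightarrow> v \<in> X \<Longrightarrow> \<rho> (T u) (T v) \<le> c * \<rho> u v"
    and s: "0 \<le> s" and c: "0 \<le> c" and sc: "s * c < 1"
    and x: "x \<in> X"
  shows "\<rho> x ((T ^^ p) x) \<le> s * \<rho> x (T x) / (1 - s * c)"
proof (induction p)
  case 0
  show ?case using refl nonneg T x s sc by simp
next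
  case (Suc p)
  define R where "R = s * \<rho> x (T x) / (1 - s * c)"
  have mem: "(T ^^ p) x \<in> X" by (induction p) (use T x in auto)
  have "\<rho> x ((T ^^ Suc p) x) \<le> s * (\<rho> x (T x) + \<rho> (T x) (T ((T ^^ p) x)))"
    using tri[of x "T x" "T ((T ^^ p) x)"] x T mem by simp
  also have "\<dots> \<le> s * (\<rho> x (T x) + c * R)"
  proof -
    have "\<rho> (T x) (T ((T ^^ p) x)) \<le> c * \<rho> x ((T ^^ p) x)"
      using contr x mem by blast
    also have "\<dots> \<le> c * R"
      using Suc.IH c unfolding R_def by (rule mult_left_mono)
    finally show ?thesis using s by (intro mult_left_mono add_left_mono)
  qed
  also have "\<dots> = R"
    using sc unfolding R_def by (simp add: field_simps)
  finally show ?case unfolding R_def .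
qed

text \<open>
  Summing the distances between consecutive iterates would pick up a factor \<open>s\<close> at every step, so
  the Cauchy property is derived differently: \<open>\<rho> (x k) (x (k + p))\<close> is at most \<open>c ^ k\<close> times the distance
  from \<open>x 0\<close> to \<open>x p\<close>, and these distances are bounded by the preceding lemma. As \<open>\<rho>\<close> need not be
  continuous, the limit is recognised as a fixed point through the relaxed triangle inequality.
\<close>

lemma b_metric_contraction_fixed_point:
  fixes \<rho> :: "'a \<Rightarrow> 'a \<Rightarrow> real"
  assumes nonempty: "X \<noteq> {}"
    and nonneg: "\<And>u v. u \<in> X \<Longrightarrow> v \<in> X \<Longrightarrow> 0 \<le> \<rho> u v"
    and zero: "\<And>u v. u \<in> X \<Longrightarrow> v \<in> X \<Longrightarrow> \<rho> u v = 0 \<longleftrightarrow> u = v"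
    and sym: "\<And>u v. u \<in> X \<Longrightarrow> v \<in> X \<Longrightarrow> \<rho> u v = \<rho> v u"
    and tri: "\<And>u v w. u \<in> X \<Longrightarrow> v \<in> X \<Longrightarrow> w \<in> X \<Longrightarrow> \<rho> u w \<le> s * (\<rho> u v + \<rho> v w)"
    and complete: "\<And>x. (\<And>k. x k \<in> X) \<Longrightarrow>
        (\<And>e. e > 0 \<Longrightarrow> \<exists>K. \<forall>k\<ge>K. \<forall>p\<ge>K. \<rho> (x k) (x p) < e) \<Longrightarrow>
        \<exists>l\<in>X. (\<lambda>k. \<rho> (x k) l) \<longlonglongrightarrow> 0"
    and T: "\<And>u. u \<in> X \<Longrightarrow> T u \<in> X"
    and contr: "\<And>u v. u \<in> X \<Longrightarrow> v \<in> X \<Longrightarrow> \<rho> (T u) (T v) \<le> c * \<rho> u v"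
    and s: "0 \<le> s" and c: "0 \<le> c" "c < 1" and sc: "s * c < 1"
  shows "\<exists>!x. x \<in> X \<and> T x = x"
proof -
  obtain x\<^sub>0 where x\<^sub>0: "x\<^sub>0 \<in> X" using nonempty by blast
  define x where "x k = (T ^^ k) x\<^sub>0" for k
  have x_Suc: "x (Suc k) = T (x k)" for k by (simp add: x_def)
  have x_mem: "x k \<in> X" for k
  proof (induction k)
    case 0
    show ?case by (simp add: x_def x\<^sub>0)
  qed (simp add: x_Suc T)
  define R where "R = s * \<rho> x\<^sub>0 (T x\<^sub>0) / (1 - s * c)"
  have bounded: "\<rho> (x 0) (x p) \<le> R" for p
    unfolding x_def R_def funpow_0
  proof (rule b_metric_orbit_bounded[where X = X and c = c])
    show "\<rho> u u = 0" if "u \<in> X" for u using zero that by blast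
  qed (fact nonneg tri T contr s c sc x\<^sub>0)+
  have gap: "\<rho> (x k) (x (k + p)) \<le> c ^ k * R" for k p
  proof (induction k)
    case 0
    show ?case using bounded by simp
  next
    case (Suc k)
    have "\<rho> (x (Suc k)) (x (Suc k + p)) \<le> c * \<rho> (x k) (x (k + p))"
      using contr x_mem by (simp add: x_Suc)
    also have "\<dots> \<le> c * (c ^ k * R)"
      using Suc.IH c(1) by (rule mult_left_mono)
    finally show ?case by (simp add: mult.assoc)
  qed
  have "\<exists>K. \<forall>k\<ge>K. \<forall>p\<ge>K. \<rho> (x k) (x p) < e" if "e > 0" for e
  proof -
    have "(\<lambda>k. c ^ k * R) \<longlonglongrightarrow> 0"
      using c by (intro tendsto_mult_left_zero LIMSEQ_realpow_zero)
    then have "\<forall>\<^sub>F k in sequentially. c ^ k * R < e"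
      using \<open>e > 0\<close> by (rule order_tendstoD(2))
    then obtain K where K: "c ^ k * R < e" if "k \<ge> K" for k
      unfolding eventually_sequentially by blast
    have ordered: "\<rho> (x k) (x p) < e" if "K \<le> k" "k \<le> p" for k p
      using gap[of k "p - k"] K[of k] that by simp
    have "\<rho> (x k) (x p) < e" if "K \<le> k" "K \<le> p" for k p
      using ordered[of k p] ordered[of p k] sym[OF x_mem x_mem, of k p] that
      by (cases "k \<le> p") auto
    then show ?thesis by blast
  qed
  then obtain l where l: "l \<in> X" and lim: "(\<lambda>k. \<rho> (x k) l) \<longlonglongrightarrow> 0"
    using complete[of x] x_mem by blast
  have "\<rho> (T l) l \<le> 0"
  proof (rule LIMSEQ_le_const)
    show "(\<lambda>k. s * (c * \<rho> (x k) l + \<rho> (x (Suc k)) l)) \<longlonglongrightarrow> 0"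
      using lim LIMSEQ_Suc[OF lim] by (auto intro!: tendsto_eq_intros)
    have "\<rho> (T l) l \<le> s * (c * \<rho> (x k) l + \<rho> (x (Suc k)) l)" for k
    proof -
      have "\<rho> (T l) l \<le> s * (\<rho> (T l) (T (x k)) + \<rho> (x (Suc k)) l)"
        using tri[of "T l" "T (x k)" l] T l x_mem by (simp add: x_Suc)
      moreover have "\<rho> (T l) (T (x k)) \<le> c * \<rho> (x k) l"
        using contr[of l "x k"] sym[of l "x k"] l x_mem by simp
      ultimately show ?thesis
        using s by (meson add_right_mono mult_left_mono order_trans)
    qed
    then show "\<exists>K. \<forall>k\<ge>K. \<rho> (T l) l \<le> s * (c * \<rho> (x k) l + \<rho> (x (Suc k)) l)" by blast
  qed
  then have fixed: "T l = l"
    using nonneg[of "T l" l] zero[of "T l" l] T l by simp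
  have "y = l" if y: "y \<in> X" "T y = y" for y
  proof (rule ccontr)
    assume "y \<noteq> l"
    then have "\<rho> y l > 0" using zero[of y l] nonneg[of y l] y l by simp
    moreover have "\<rho> y l \<le> c * \<rho> y l" using contr[of y l] y l fixed by simp
    ultimately show False using c(2) by simp
  qed
  with l fixed show ?thesis by blast
qed

section \<open>Vector-valued metrics and matrices\<close>

text \<open>Cauchy-Schwarz in every row; the norm of a matrix is here its Frobenius norm.\<close>

lemma norm_matrix_vector_mult_le:
  fixes M :: "real ^ 'n ^ 'm"
  shows "norm (M *v x) \<le> norm M * norm x"
proof -
  have "norm (M *v x) = L2_set (\<lambda>i. norm ((M *v x) $ i)) UNIV"
    by (simp add: norm_vec_def)
  also have "\<dots> \<le> L2_set (\<lambda>i. norm (M $ i) * norm x) UNIV"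
    by (rule L2_set_mono) (simp_all add: matrix_vector_mul_component Cauchy_Schwarz_ineq2)
  also have "\<dots> = norm M * norm x"
    by (simp add: norm_vec_def[of M] L2_set_left_distrib)
  finally show ?thesis .
qed

lemma norm_mono_nonneg_vec:
  fixes x y :: "real ^ 'n"
  assumes "0 \<le> x" "x \<le> y"
  shows "norm x \<le> norm y"
proof (rule norm_le_componentwise_cart)
  fix i
  have "0 \<le> x $ i" "x $ i \<le> y $ i"
    using assms by (simp_all add: less_eq_vec_def)
  then show "norm (x $ i) \<le> norm (y $ i)" by simp
qed

lemma positive_mat_mono:
  assumes "positive_mat M" "x \<le> y"
  shows "M *v x \<le> M *v y"
  using assms unfolding positive_mat_def less_eq_vec_def matrix_vector_mult_def
  by (auto intro!: sum_mono mult_left_mono)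

lemma funpow_matpow_contraction:
  assumes A: "positive_mat A"
    and N: "N \<in> X \<rightarrow> X"
    and contr: "\<And>x y. x \<in> X \<Longrightarrow> y \<in> X \<Longrightarrow> d (N x) (N y) \<le> A *v d x y"
    and "x \<in> X" "y \<in> X"
  shows "d ((N ^^ m) x) ((N ^^ m) y) \<le> matpow A m *v d x y"
proof (induction m)
  case 0
  show ?case by simp
next
  case (Suc m)
  have mem: "(N ^^ m) z \<in> X" if "z \<in> X" for z
    by (induction m) (use N that in auto)
  have "d ((N ^^ Suc m) x) ((N ^^ Suc m) y) \<le> A *v d ((N ^^ m) x) ((N ^^ m) y)"
    using contr mem \<open>x \<in> X\<close> \<open>y \<in> X\<close> by simp
  also have "\<dots> \<le> A *v (matpow A m *v d x y)"
    by (rule positive_mat_mono[OF A Suc.IH])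
  finally show ?case by (simp add: matrix_vector_mul_assoc)
qed

lemma vCauchy_iff_norm:
  "vCauchy d x \<longleftrightarrow> (\<forall>e>0. \<exists>K. \<forall>k\<ge>K. \<forall>p\<ge>K. norm (d (x k) (x p)) < e)"
  unfolding vCauchy_def tendsto_iff eventually_prod_sequentially dist_norm
  by simp (intro iffI allI impI; blast)

lemma fixed_point_of_funpow_fixed_point:
  assumes N: "N \<in> X \<rightarrow> X"
    and ex1: "\<exists>!x. x \<in> X \<and> (N ^^ m) x = x"
  shows "\<exists>!x. x \<in> X \<and> N x = x"
proof -
  from ex1 obtain x where x: "x \<in> X" "(N ^^ m) x = x"
    and uniq: "\<And>y. y \<in> X \<Longrightarrow> (N ^^ m) y = y \<Longrightarrow> y = x" by blast
  \<comment> \<open>\<open>N\<close> commutes with its iterates.\<close>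
  have "(N ^^ m) (N x) = N x"
    by (simp add: funpow_swap1[symmetric] x)
  then have "N x = x" using uniq N x by blast
  moreover have "(N ^^ m) y = y" if "N y = y" for y
    by (induction m) (simp_all add: that)
  ultimately show ?thesis using x(1) uniq by blast
qed

theorem theorem3p1:
  fixes B :: "real ^ 'n ^ 'n"
    and X :: "'a set"
    and d :: "'a \<Rightarrow> 'a \<Rightarrow> real ^ 'n"
    and N :: "'a \<Rightarrow> 'a"
  assumes "positive_mat B \<or> inverse_positive_mat B"
    and "X \<noteq> {}"
    and "vector_B_metric B X d"
    and "vcomplete X d"
    and "N \<in> X \<rightarrow> X"
    and "\<exists>A :: real ^ 'n ^ 'n. positive_mat A \<and> convergent_to_zero A \<and>
           (\<forall>x\<in>X. \<forall>y\<in>X. d (N x) (N y) \<le> A *v d x y)"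
  shows "\<exists>!x. x \<in> X \<and> N x = x"
proof -
  have d_nonneg: "0 \<le> d u v" and d_zero: "d u v = 0 \<longleftrightarrow> u = v" and d_sym: "d u v = d v u"
    if "u \<in> X" "v \<in> X" for u v
    using assms(3) that unfolding vector_B_metric_def by simp_all
  have d_tri: "d u w \<le> B *v (d u v + d v w)" if "u \<in> X" "v \<in> X" "w \<in> X" for u v w
    using assms(3) that unfolding vector_B_metric_def by simp
  obtain A :: "real ^ 'n ^ 'n" where A: "positive_mat A" "matpow A \<longlonglongrightarrow> 0"
    and contr: "\<And>x y. x \<in> X \<Longrightarrow> y \<in> X \<Longrightarrow> d (N x) (N y) \<le> A *v d x y"
    using assms(6) unfolding convergent_to_zero_def by blast
  \<comment> \<open>The bound \<open>norm (matpow A m) < 1\<close> is asked for separately because \<open>norm B\<close> may be below 1.\<close>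
  have "(\<lambda>m. norm (matpow A m)) \<longlonglongrightarrow> 0"
    using A(2) by (rule tendsto_norm_zero)
  moreover from this have "(\<lambda>m. norm B * norm (matpow A m)) \<longlonglongrightarrow> 0"
    by (rule tendsto_mult_right_zero)
  ultimately have "\<forall>\<^sub>F m in sequentially. norm (matpow A m) < 1 \<and> norm B * norm (matpow A m) < 1"
    by (intro eventually_conj order_tendstoD(2)[where a = 1]) auto
  then obtain m where m: "norm (matpow A m) < 1" "norm B * norm (matpow A m) < 1"
    using eventually_happens'[OF sequentially_bot] by blast
  have "\<exists>!x. x \<in> X \<and> (N ^^ m) x = x"
  proof (rule b_metric_contraction_fixed_point[where \<rho> = "\<lambda>u v. norm (d u v)"])
    show mem: "(N ^^ m) u \<in> X" if "u \<in> X" for u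
      by (induction m) (use assms(5) that in auto)
    show "norm (d u w) \<le> norm B * (norm (d u v) + norm (d v w))"
      if "u \<in> X" "v \<in> X" "w \<in> X" for u v w
    proof -
      have "norm (d u w) \<le> norm (B *v (d u v + d v w))"
        using that by (intro norm_mono_nonneg_vec d_nonneg d_tri)
      also have "\<dots> \<le> norm B * norm (d u v + d v w)"
        by (rule norm_matrix_vector_mult_le)
      also have "\<dots> \<le> norm B * (norm (d u v) + norm (d v w))"
        by (intro mult_left_mono norm_triangle_ineq norm_ge_zero)
      finally show ?thesis .
    qed
    show "norm (d ((N ^^ m) u) ((N ^^ m) v)) \<le> norm (matpow A m) * norm (d u v)"
      if "u \<in> X" "v \<in> X" for u v
    proof -
      have "norm (d ((N ^^ m) u) ((N ^^ m) v)) \<le> norm (matpow A m *v d u v)"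
        using that funpow_matpow_contraction[OF A(1) assms(5), of d u v m] contr
        by (intro norm_mono_nonneg_vec d_nonneg mem) auto
      also have "\<dots> \<le> norm (matpow A m) * norm (d u v)"
        by (rule norm_matrix_vector_mult_le)
      finally show ?thesis .
    qed
    show "\<exists>l\<in>X. (\<lambda>k. norm (d (x k) l)) \<longlonglongrightarrow> 0"
      if "\<And>k. x k \<in> X"
        and "\<And>e. e > 0 \<Longrightarrow> \<exists>K. \<forall>k\<ge>K. \<forall>p\<ge>K. norm (d (x k) (x p)) < e" for x
      using assms(4) that unfolding vcomplete_def vCauchy_iff_norm vconverges_def tendsto_norm_zero_iff
      by blast
  qed (use assms(2) m d_zero d_sym in auto)
  then show ?thesis
    by (rule fixed_point_of_funpow_fixed_point[OF assms(5)])
qed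

end
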